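(* Assume the asymptotic setting below together with conditions (A1)–(A3). Then $$\Big|\frac{\hat b_S}{\mathrm{tr}(W)}-\frac{b^*}{\mathrm{tr}(W)}\Big|\to0\quad\text{almost surely as }n\to\infty.$$
   Context: Asymptotic setting. For each $n$, let $p=p_n$ and let $\Psi=\Psi_n$ be a $p\times p$ positive definite matrix. Let $Y$ be a $p\times(n-1)$ random matrix with i.i.d. columns distributed as $\mathcal N_p(0,\Psi)$, and $W=YY^\top$. (This arises from the Bayesian model $x_i\mid\theta_i\sim\mathcal N_p(\theta_i,I_p)$, $\theta_i\mid\mu\sim\mathcal N_p(\mu,\Lambda)$, $\mu$ flat on $\mathbb R^p$, with $\Psi=I_p+\Lambda$ and $W=(X-\bar X)(X-\bar X)^\top$.) Let $\hat\alpha\ge0$ be a scalar statistic (function of $W$), $c_0\ge0$ a fixed constant, $V=(W+\hat\alpha I_p)^{-1}$, and define $$\hat a_S=\frac{(n-p-1)\mathrm{tr}(V)+\hat\alpha(\mathrm{tr}V)^2}{\mathrm{tr}(V^2W)}-(2c_0+1),\quad \hat b_S=\{(n-1)p-2\}-\mathrm{tr}(VW)\hat a_S,\quad b^*=-\hat a_S\,\mathrm{tr}(VW)+\mathrm{tr}(W\Psi^{-1}).$$ ($b^*$ minimizes over $b$ the loss $\frac1{np}\mathrm{tr}\{(\hat a_SV+b(\mathrm{tr}W)^{-1}I_p-\Psi^{-1})^2W\}$.) Conditions: (A1) $n/p\to\gamma$ as $n\to\infty$, where $0<\gamma<\infty$ and $\gamma\ne1$. (A2) There are constants $0<c_1\le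 c_2$ such that all eigenvalues $\tau_1,\dots,\tau_p$ of $\Psi$ lie in $[c_1,c_2]$ for all $n$, and the empirical spectral distribution $H_p(\tau)=p^{-1}\sum_{j=1}^p1_{[\tau_j,\infty)}(\tau)$ converges to a nonrandom probability distribution $H$. (A3) $\hat\alpha/n\to\alpha$ almost surely as $n\to\infty$, for some constant $\alpha>0$. *)

theory Defs
  imports "HOL-Probability.Probability" "Jordan_Normal_Form.Matrix" "Jordan_Normal_Form.Determinant"
    "Jordan_Normal_Form.Char_Poly"
begin

definition mat_tr :: "real mat \<Rightarrow> real" where
  "mat_tr A = (\<Sum>i<dim_row A. A $$ (i, i))"

text \<open>Inverse of a square matrix (unspecified if the matrix is singular).\<close>
definition mat_inv :: "real mat \<Rightarrow> real mat" where
  "mat_inv A = (SOME B. B \<in> carrier_mat (dim_row A) (dim_row A) \<and>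
       A * B = one_mat (dim_row A) \<and> B * A = one_mat (dim_row A))"

definition sym_posdef :: "nat \<Rightarrow> real mat \<Rightarrow> bool" where
  "sym_posdef p A \<longleftrightarrow> A \<in> carrier_mat p p \<and> transpose_mat A = A \<and>
     (\<forall>x \<in> carrier_vec p. x \<noteq> zero_vec p \<longrightarrow> scalar_prod x (mult_mat_vec A x) > 0)"

text \<open>Density of the p-variate normal distribution N_p(0,Psi) w.r.t. Lebesgue measure on R^p
  (vectors represented as functions on {..<p}).\<close>
definition mvn_density :: "nat \<Rightarrow> real mat \<Rightarrow> (nat \<Rightarrow> real) \<Rightarrow> real" where
  "mvn_density p Psi x =
     exp (- scalar_prod (vec p x) (mult_mat_vec (mat_inv Psi) (vec p x)) / 2)
     / sqrt ((2 * pi) ^ p * det Psi)"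

text \<open>Empirical spectral distribution of a (symmetric) matrix: eigenvalues counted with
  algebraic multiplicity, as roots of the characteristic polynomial.\<close>
definition esd :: "real mat \<Rightarrow> real \<Rightarrow> real" where
  "esd A t = (\<Sum>r \<in> {r. poly (char_poly A) r = 0 \<and> r \<le> t}. real (order r (char_poly A)))
              / real (dim_row A)"

definition Ymat :: "nat \<Rightarrow> nat \<Rightarrow> (nat \<Rightarrow> nat \<Rightarrow> real) \<Rightarrow> real mat" where
  "Ymat p n y = mat p (n - 1) (\<lambda>(i, j). y i j)"

definition Wmat :: "nat \<Rightarrow> nat \<Rightarrow> (nat \<Rightarrow> nat \<Rightarrow> real) \<Rightarrow> real mat" where
  "Wmat p n y = Ymat p n y * transpose_mat (Ymat p n y)"

definition Vmat :: "nat \<Rightarrow> real mat \<Rightarrow> real \<Rightarrow> real mat" where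
  "Vmat p W a = mat_inv (W + smult_mat a (one_mat p))"

definition a_S :: "nat \<Rightarrow> nat \<Rightarrow> real \<Rightarrow> real mat \<Rightarrow> real \<Rightarrow> real" where
  "a_S n p c0 W a = (let V = Vmat p W a in
     ((real n - real p - 1) * mat_tr V + a * (mat_tr V)^2) / mat_tr (V * V * W) - (2 * c0 + 1))"

definition b_S :: "nat \<Rightarrow> nat \<Rightarrow> real \<Rightarrow> real mat \<Rightarrow> real \<Rightarrow> real" where
  "b_S n p c0 W a = ((real n - 1) * real p - 2) - mat_tr (Vmat p W a * W) * a_S n p c0 W a"

definition b_star :: "nat \<Rightarrow> nat \<Rightarrow> real \<Rightarrow> real mat \<Rightarrow> real \<Rightarrow> real mat \<Rightarrow> real" where
  "b_star n p c0 W a Psi = - a_S n p c0 W a * mat_tr (Vmat p W a * W) + mat_tr (W * mat_inv Psi)"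

end

theory Submission
  imports Defs
begin

text \<open>In \<open>b_S - b_star\<close> all terms involving \<open>V\<close> cancel, leaving \<open>N - 2 - Q\<close> with
  \<open>N = (n - 1) p\<close> and \<open>Q = tr (W Psi\<inverse>)\<close>, a sum of the quadratic forms \<open>y\<^sub>j\<^sup>T Psi\<inverse> y\<^sub>j\<close> of the columns.
  Rescaling the normal density shows that each form has the moment generating function
  \<open>(1 - t) powr (- p / 2)\<close> at \<open>t / 2\<close>; Chernoff bounds and the Borel-Cantelli lemma give \<open>Q / N \<longlongrightarrow> 1\<close> almost
  surely. Since all eigenvalues of \<open>Psi\<close> are at least \<open>c\<^sub>1\<close>, also \<open>tr W \<ge> c\<^sub>1 Q\<close>.\<close>

section \<open>Quadratic forms of real matrices and the smallest eigenvalue\<close>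

lemma scalar_prod_self_ge_0:
  fixes x :: "real Matrix.vec"
  shows "0 \<le> scalar_prod x x"
  by (simp add: scalar_prod_def sum_nonneg)

lemma scalar_prod_self_pos:
  fixes x :: "real Matrix.vec"
  assumes "x \<in> carrier_vec n" "x \<noteq> 0\<^sub>v n"
  shows "0 < scalar_prod x x"
proof -
  obtain i where i: "i < n" "vec_index x i \<noteq> 0"
    using assms eq_vecI[of x "0\<^sub>v n"] by (metis carrier_vecD index_zero_vec)
  show ?thesis
    unfolding scalar_prod_def
    by (rule sum_pos2[where i = i]) (use i assms in \<open>auto simp: zero_less_mult_iff neq_iff\<close>)
qed

lemma invertible_matE:
  fixes A :: "real mat"
  assumes "A \<in> carrier_mat n n" "det A \<noteq> 0"
  obtains B where "B \<in> carrier_mat n n" "A * B = 1\<^sub>m n" "B * A = 1\<^sub>m n"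
  using det_non_zero_imp_unit[OF assms, of n] that
  by (auto simp: Units_def ring_mat_def)

text \<open>A crude constant suffices, because only some upper bound for the form of an inverse
  matrix is wanted below. Each product of two coordinates is at most \<open>x \<bullet> x\<close> by
  the arithmetic-geometric mean inequality, so the absolute entries can simply be summed.\<close>

lemma quadratic_form_bound:
  fixes B :: "real mat"
  assumes B: "B \<in> carrier_mat n n"
  obtains K where "0 < K" "\<And>x. x \<in> carrier_vec n \<Longrightarrow> scalar_prod (B *\<^sub>v x) x \<le> K * scalar_prod x x"
proof
  \<comment> \<open>The added 1 keeps \<open>K\<close> positive even when all entries vanish or
    \<open>n = 0\<close>, so that \<open>1 / K\<close> can be used later.\<close>
  define K where "K = 1 + (\<Sum>i<n. \<Sum>k<n. \<bar>B $$ (i, k)\<bar>)"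
  show "0 < K" unfolding K_def by (intro add_pos_nonneg sum_nonneg) auto
  fix x :: "real Matrix.vec" assume x: "x \<in> carrier_vec n"
  let ?s = "scalar_prod x x"
  have sq: "(vec_index x i)\<^sup>2 \<le> ?s" if "i < n" for i
    unfolding scalar_prod_def power2_eq_square using that x
    by (intro member_le_sum[where f = "\<lambda>i. vec_index x i * vec_index x i"]) auto
  have prod: "\<bar>vec_index x i\<bar> * \<bar>vec_index x k\<bar> \<le> ?s" if "i < n" "k < n" for i k
    using sum_squares_bound[of "\<bar>vec_index x i\<bar>" "\<bar>vec_index x k\<bar>"] sq[OF that(1)] sq[OF that(2)]
    by simp
  have "scalar_prod (B *\<^sub>v x) x = (\<Sum>i<n. \<Sum>k<n. B $$ (i, k) * (vec_index x k * vec_index x i))"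
    using B x by (simp add: scalar_prod_def sum_distrib_right mult.assoc atLeast0LessThan)
  also have "\<dots> \<le> (\<Sum>i<n. \<Sum>k<n. \<bar>B $$ (i, k)\<bar> * ?s)"
  proof (intro sum_mono)
    fix i k assume "i \<in> {..<n}" "k \<in> {..<n}"
    then have "\<bar>B $$ (i, k)\<bar> * (\<bar>vec_index x k\<bar> * \<bar>vec_index x i\<bar>) \<le> \<bar>B $$ (i, k)\<bar> * ?s"
      by (intro mult_left_mono prod) auto
    then show "B $$ (i, k) * (vec_index x k * vec_index x i) \<le> \<bar>B $$ (i, k)\<bar> * ?s"
      using abs_ge_self[of "B $$ (i, k) * (vec_index x k * vec_index x i)"] by (simp add: abs_mult)
  qed
  also have "\<dots> = (K - 1) * ?s"
    by (simp add: K_def sum_distrib_right)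
  also have "\<dots> \<le> K * ?s"
    using scalar_prod_self_ge_0[of x] by (simp add: algebra_simps)
  finally show "scalar_prod (B *\<^sub>v x) x \<le> K * ?s" .
qed

text \<open>With \<open>z = A\<inverse> x\<close> and \<open>z \<bullet> x \<le> K (x \<bullet> x)\<close>, expand \<open>0 \<le> (x - z / K) \<bullet> A (x - z / K)\<close>.\<close>

lemma psd_invertible_coercive:
  fixes A :: "real mat"
  assumes A: "A \<in> carrier_mat n n" and sym: "transpose_mat A = A" and det: "det A \<noteq> 0"
    and psd: "\<And>x. x \<in> carrier_vec n \<Longrightarrow> 0 \<le> scalar_prod x (A *\<^sub>v x)"
  obtains e where "0 < e" "\<And>x. x \<in> carrier_vec n \<Longrightarrow> e * scalar_prod x x \<le> scalar_prod x (A *\<^sub>v x)"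
proof -
  obtain B where B: "B \<in> carrier_mat n n" "A * B = 1\<^sub>m n"
    using invertible_matE[OF A det] by metis
  obtain K where K: "0 < K"
    "\<And>x. x \<in> carrier_vec n \<Longrightarrow> scalar_prod (B *\<^sub>v x) x \<le> K * scalar_prod x x"
    using quadratic_form_bound[OF B(1)] by metis
  have "1 / K * scalar_prod x x \<le> scalar_prod x (A *\<^sub>v x)" if x: "x \<in> carrier_vec n" for x
  proof -
    \<comment> \<open>Here \<open>z\<close> already carries the factor \<open>1 / K\<close>, so
      \<open>A z = x / K\<close>. By symmetry both cross terms equal
      \<open>(x \<bullet> x) / K\<close>, and the choice of \<open>K\<close> bounds
      \<open>z \<bullet> A z\<close> by the same quantity.\<close>
    define z where "z = (1 / K) \<cdot>\<^sub>v (B *\<^sub>v x)"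
    have Bx: "B *\<^sub>v x \<in> carrier_vec n" using B(1) x by (rule mult_mat_vec_carrier)
    then have z: "z \<in> carrier_vec n" by (simp add: z_def)
    have "A *\<^sub>v z = (1 / K) \<cdot>\<^sub>v ((A * B) *\<^sub>v x)"
      using A B(1) x Bx by (simp add: z_def mult_mat_vec assoc_mult_mat_vec)
    then have Az: "A *\<^sub>v z = (1 / K) \<cdot>\<^sub>v x"
      using B(2) x by simp
    have Ax: "A *\<^sub>v x \<in> carrier_vec n" using A x by (rule mult_mat_vec_carrier)
    have "scalar_prod z (A *\<^sub>v x) = scalar_prod (A *\<^sub>v z) x"
      using transpose_vec_mult_scalar[OF A x z] sym by simp
    also have "\<dots> = 1 / K * scalar_prod x x"
      using x unfolding Az by simp
    finally have zAx: "scalar_prod z (A *\<^sub>v x) = 1 / K * scalar_prod x x" .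
    have xAz: "scalar_prod x (A *\<^sub>v z) = 1 / K * scalar_prod x x"
      using x unfolding Az by simp
    have "scalar_prod z (A *\<^sub>v z) = 1 / K * scalar_prod z x"
      using x z unfolding Az by simp
    also have "\<dots> = 1 / K * (1 / K * scalar_prod (B *\<^sub>v x) x)"
      using x Bx unfolding z_def by simp
    also have "\<dots> \<le> 1 / K * (1 / K * (K * scalar_prod x x))"
      using K x by (intro mult_left_mono) auto
    finally have zAz: "scalar_prod z (A *\<^sub>v z) \<le> 1 / K * scalar_prod x x"
      using K(1) by simp
    have "0 \<le> scalar_prod (x - z) (A *\<^sub>v (x - z))"
      using x z by (intro psd) auto
    also have "\<dots> = scalar_prod x (A *\<^sub>v x) - scalar_prod x (A *\<^sub>v z)
        - (scalar_prod z (A *\<^sub>v x) - scalar_prod z (A *\<^sub>v z))"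
    proof -
      have "A *\<^sub>v z \<in> carrier_vec n" using A z by (rule mult_mat_vec_carrier)
      then show ?thesis
        using mult_minus_distrib_mat_vec[OF A x z] Ax x z
        by (simp add: minus_scalar_prod_distrib[of _ n] scalar_prod_minus_distrib[of _ n])
    qed
    finally show ?thesis using zAx xAz zAz by simp
  qed
  then show ?thesis using that[of "1 / K"] K(1) by simp
qed

text \<open>The infimum \<open>m\<close> of the Rayleigh quotient is an eigenvalue: otherwise \<open>A - m I\<close> would be coercive
  and \<open>m\<close> could be increased.\<close>

lemma rayleigh_lower_bound:
  fixes A :: "real mat"
  assumes pd: "sym_posdef n A"
    and ev: "\<And>r. poly (char_poly A) r = 0 \<Longrightarrow> c \<le> r"
    and x: "x \<in> carrier_vec n"
  shows "c * scalar_prod x x \<le> scalar_prod x (A *\<^sub>v x)"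
proof (cases "x = 0\<^sub>v n")
  case True
  then show ?thesis using pd by (auto simp: sym_posdef_def)
next
  case False
  have A: "A \<in> carrier_mat n n" "transpose_mat A = A"
    using pd by (auto simp: sym_posdef_def)
  define R where "R = (\<lambda>x. scalar_prod x (A *\<^sub>v x) / scalar_prod x x) ` (carrier_vec n - {0\<^sub>v n})"
  define m where "m = Inf R"
  \<comment> \<open>The zero vector was split off first so that \<open>x\<close> itself provides a
    Rayleigh quotient and the infimum is meaningful.\<close>
  have "R \<noteq> {}" using x False by (auto simp: R_def)
  have bdd: "bdd_below R"
    by (rule bdd_belowI[where m = 0])
       (use pd in \<open>force simp: R_def sym_posdef_def intro!: divide_nonneg_nonneg scalar_prod_self_ge_0\<close>)
  have m_le: "m * scalar_prod y y \<le> scalar_prod y (A *\<^sub>v y)" if y: "y \<in> carrier_vec n" for y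
  proof (cases "y = 0\<^sub>v n")
    case True
    then show ?thesis using A by auto
  next
    case False
    then have "m \<le> scalar_prod y (A *\<^sub>v y) / scalar_prod y y"
      unfolding m_def using y bdd by (intro cInf_lower) (auto simp: R_def)
    then show ?thesis using scalar_prod_self_pos[OF y False] by (simp add: field_simps)
  qed
  define C where "C = char_matrix A m"
  have C: "C \<in> carrier_mat n n" using A by (simp add: C_def)
  have symC: "transpose_mat C = C"
  proof -
    have "A $$ (i, j) = A $$ (j, i)" if "i < n" "j < n" for i j
      using A that by (metis carrier_matD index_transpose_mat(1))
    then show ?thesis
      using A(1) unfolding C_def char_matrix_def by (intro eq_matI) auto
  qed
  have Cy: "scalar_prod y (C *\<^sub>v y) = scalar_prod y (A *\<^sub>v y) - m * scalar_prod y y"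
    if y: "y \<in> carrier_vec n" for y
  proof -
    have "C *\<^sub>v y = A *\<^sub>v y + (- m) \<cdot>\<^sub>v y"
      using A(1) y unfolding C_def char_matrix_def
      by (intro eq_vecI) (auto simp: add_scalar_prod_distrib[of _ n])
    then show ?thesis using A(1) y by (simp add: scalar_prod_add_distrib[of _ n])
  qed
  have "det C = 0"
  proof (rule ccontr)
    assume "det C \<noteq> 0"
    then obtain e where e: "0 < e"
      "\<And>y. y \<in> carrier_vec n \<Longrightarrow> e * scalar_prod y y \<le> scalar_prod y (C *\<^sub>v y)"
      using psd_invertible_coercive[OF C symC] Cy m_le by (metis diff_ge_0_iff_ge)
    have "m + e \<le> r" if r: "r \<in> R" for r
    proof -
      obtain y where y: "y \<in> carrier_vec n" "y \<noteq> 0\<^sub>v n"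
        "r = scalar_prod y (A *\<^sub>v y) / scalar_prod y y"
        using r by (auto simp: R_def)
      have "(m + e) * scalar_prod y y \<le> scalar_prod y (A *\<^sub>v y)"
        using e(2)[OF y(1)] Cy[OF y(1)] by (simp add: algebra_simps)
      then show ?thesis
        using scalar_prod_self_pos[OF y(1,2)] by (simp add: y(3) pos_le_divide_eq)
    qed
    then have "m + e \<le> m" unfolding m_def using \<open>R \<noteq> {}\<close> by (intro cInf_greatest)
    then show False using e(1) by simp
  qed
  \<comment> \<open>Singularity of \<open>A - m I\<close> makes \<open>m\<close> a root of the
    characteristic polynomial, so the assumed bound on the roots applies to it.\<close>
  then have "c \<le> m"
    using ev eigenvalue_det[OF A(1)] eigenvalue_root_char_poly[OF A(1)] by (simp add: C_def)
  then have "c * scalar_prod x x \<le> m * scalar_prod x x"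
    by (intro mult_right_mono scalar_prod_self_ge_0)
  then show ?thesis using m_le[OF x] by linarith
qed

text \<open>\<open>mat_inv\<close> is a choice, so an inverse must exist before anything is known
  about it. A nonzero kernel vector would contradict positive definiteness, hence the determinant is
  nonzero.\<close>

lemma sym_posdef_mat_inv:
  assumes pd: "sym_posdef n A"
  shows "mat_inv A \<in> carrier_mat n n" "A * mat_inv A = 1\<^sub>m n" "mat_inv A * A = 1\<^sub>m n"
proof -
  have A: "A \<in> carrier_mat n n" using pd by (auto simp: sym_posdef_def)
  have "det A \<noteq> 0"
    using pd det_0_iff_vec_prod_zero[OF A] by (force simp: sym_posdef_def)
  then obtain B where "B \<in> carrier_mat n n" "A * B = 1\<^sub>m n" "B * A = 1\<^sub>m n"
    using invertible_matE[OF A] by metis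
  then have "\<exists>B. B \<in> carrier_mat (dim_row A) (dim_row A) \<and>
       A * B = one_mat (dim_row A) \<and> B * A = one_mat (dim_row A)"
    using A by auto
  from someI_ex[OF this]
  show "mat_inv A \<in> carrier_mat n n" "A * mat_inv A = 1\<^sub>m n" "mat_inv A * A = 1\<^sub>m n"
    using A by (simp_all add: mat_inv_def)
qed

text \<open>With \<open>z = mat_inv A y\<close>, the Rayleigh bound gives
  \<open>c (z \<bullet> z) \<le> y \<bullet> z\<close>. Inserting this into the expansion of
  \<open>|y - c z|^2 \<ge> 0\<close> gives the claim without diagonalizing \<open>A\<close>.\<close>

lemma mat_inv_quadratic_form_le:
  assumes pd: "sym_posdef n A" and c: "0 < c"
    and ev: "\<And>r. poly (char_poly A) r = 0 \<Longrightarrow> c \<le> r"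
    and y: "y \<in> carrier_vec n"
  shows "c * scalar_prod y (mat_inv A *\<^sub>v y) \<le> scalar_prod y y"
proof -
  note I = sym_posdef_mat_inv[OF pd]
  have A: "A \<in> carrier_mat n n" using pd by (auto simp: sym_posdef_def)
  define z where "z = mat_inv A *\<^sub>v y"
  have z: "z \<in> carrier_vec n" unfolding z_def using I(1) y by (rule mult_mat_vec_carrier)
  have "A *\<^sub>v z = (A * mat_inv A) *\<^sub>v y"
    using A I(1) y by (simp add: z_def)
  then have Az: "A *\<^sub>v z = y" using I(2) y by simp
  have zy: "scalar_prod z y = scalar_prod y z" using y z by (rule comm_scalar_prod[rotated])
  have le: "c * scalar_prod z z \<le> scalar_prod y z"
    using rayleigh_lower_bound[OF pd ev z] by (simp add: Az zy)
  have cz: "c \<cdot>\<^sub>v z \<in> carrier_vec n" using z by simp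
  have "0 \<le> scalar_prod (y - c \<cdot>\<^sub>v z) (y - c \<cdot>\<^sub>v z)"
    by (rule scalar_prod_self_ge_0)
  also have "\<dots> = scalar_prod y y - 2 * c * scalar_prod y z + c * (c * scalar_prod z z)"
    using y z cz by (simp add: minus_scalar_prod_distrib[of _ n] scalar_prod_minus_distrib[of _ n] zy
      right_diff_distrib)
  also have "\<dots> \<le> scalar_prod y y - 2 * c * scalar_prod y z + c * scalar_prod y z"
    using le c by simp
  finally show ?thesis by (simp add: z_def)
qed

section \<open>Traces involving W as sums over the columns\<close>

lemma mat_tr_Wmat:
  "mat_tr (Wmat p n y) = (\<Sum>j<n - 1. scalar_prod (Matrix.vec p (\<lambda>i. y i j)) (Matrix.vec p (\<lambda>i. y i j)))"
  unfolding mat_tr_def Wmat_def Ymat_def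
  by (simp add: scalar_prod_def atLeast0LessThan) (rule sum.swap)

text \<open>This is cyclicity of the trace, entry by entry: exchanging the finite sums moves the
  column index outside and puts the row index of \<open>B\<close> before its column index.\<close>

lemma mat_tr_Wmat_mult:
  assumes B: "B \<in> carrier_mat p p"
  shows "mat_tr (Wmat p n y * B) =
    (\<Sum>j<n - 1. scalar_prod (Matrix.vec p (\<lambda>i. y i j)) (B *\<^sub>v Matrix.vec p (\<lambda>i. y i j)))"
proof -
  have "mat_tr (Wmat p n y * B) = (\<Sum>i<p. \<Sum>k<p. \<Sum>j<n - 1. y i j * y k j * B $$ (k, i))"
    unfolding mat_tr_def Wmat_def Ymat_def using B
    by (simp add: scalar_prod_def atLeast0LessThan sum_distrib_right)
  also have "\<dots> = (\<Sum>k<p. \<Sum>i<p. \<Sum>j<n - 1. y i j * y k j * B $$ (k, i))"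
    by (rule sum.swap)
  also have "\<dots> = (\<Sum>k<p. \<Sum>j<n - 1. \<Sum>i<p. y i j * y k j * B $$ (k, i))"
    by (rule sum.cong[OF refl], rule sum.swap)
  also have "\<dots> = (\<Sum>j<n - 1. \<Sum>k<p. \<Sum>i<p. y i j * y k j * B $$ (k, i))"
    by (rule sum.swap)
  also have "\<dots> = (\<Sum>j<n - 1. scalar_prod (Matrix.vec p (\<lambda>i. y i j)) (B *\<^sub>v Matrix.vec p (\<lambda>i. y i j)))"
    using B by (simp add: scalar_prod_def atLeast0LessThan sum_distrib_left mult_ac)
  finally show ?thesis .
qed

section \<open>Dilation of Lebesgue measure on a finite product\<close>

text \<open>A finite product measure is determined by its values on boxes, where each coordinate
  contributes one factor \<open>c\<close> from the one-dimensional scaling rule.\<close>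

lemma nn_integral_PiM_lborel_scale:
  fixes c :: real
  assumes f: "f \<in> borel_measurable (PiM I (\<lambda>_. lborel))" and c: "0 < c" and I: "finite I"
  shows "(\<integral>\<^sup>+x. f x \<partial>PiM I (\<lambda>_. lborel)) =
    ennreal (c ^ card I) * (\<integral>\<^sup>+x. f (\<lambda>i\<in>I. c * x i) \<partial>PiM I (\<lambda>_. lborel))"
proof -
  interpret product_sigma_finite "\<lambda>_ :: 'a. lborel :: real measure" ..
  let ?P = "PiM I (\<lambda>_. lborel :: real measure)"
  \<comment> \<open>Points of the product space are extensional functions, so the dilation has to be
    restricted to \<open>I\<close>.\<close>
  let ?s = "\<lambda>x. \<lambda>i\<in>I. c * x i"
  have s [measurable]: "?s \<in> measurable ?P ?P"
    by (intro measurable_restrict) measurable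
  have scale: "emeasure lborel A = ennreal c * emeasure lborel ((*) c -` A)" 
    if [measurable]: "A \<in> sets borel" for A :: "real set"
  proof -
    have "emeasure lborel A = emeasure (density (distr lborel borel ((*) c)) (\<lambda>_. \<bar>c\<bar>)) A"
      using lborel_distr_mult'[of c] c by simp
    also have "\<dots> = ennreal c * emeasure lborel ((*) c -` A)"
      using c by (simp add: emeasure_density_const emeasure_distr)
    finally show ?thesis .
  qed
  have eq: "density (distr ?P ?P ?s) (\<lambda>_. ennreal (c ^ card I)) = ?P"
  proof (rule PiM_eqI[OF I])
    fix A :: "'a \<Rightarrow> real set" assume A: "\<And>i. i \<in> I \<Longrightarrow> A i \<in> sets lborel"
    have A': "(*) c -` A i \<in> sets borel" if "i \<in> I" for i
    proof -
      have [measurable]: "A i \<in> sets borel" using A[OF that] by simp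
      have "(*) c -` A i \<inter> space borel \<in> sets borel" by measurable
      then show ?thesis by simp
    qed
    have PA: "Pi\<^sub>E I A \<in> sets ?P" using A I by (intro sets_PiM_I_finite) auto
    have "?s -` Pi\<^sub>E I A \<inter> space ?P = Pi\<^sub>E I (\<lambda>i. (*) c -` A i)"
      by (auto simp: space_PiM PiE_iff extensional_def)
    then have "emeasure (density (distr ?P ?P ?s) (\<lambda>_. ennreal (c ^ card I))) (Pi\<^sub>E I A)
        = ennreal (c ^ card I) * emeasure ?P (Pi\<^sub>E I (\<lambda>i. (*) c -` A i))"
      using PA s by (simp add: emeasure_density_const emeasure_distr)
    also have "\<dots> = ennreal (c ^ card I) * (\<Prod>i\<in>I. emeasure lborel ((*) c -` A i))"
      using I A' by (subst emeasure_PiM) auto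
    also have "\<dots> = (\<Prod>i\<in>I. ennreal c * emeasure lborel ((*) c -` A i))"
      using c by (simp add: prod.distrib ennreal_power)
    also have "\<dots> = (\<Prod>i\<in>I. emeasure lborel (A i))"
      using A by (intro prod.cong) (auto simp: scale)
    finally show "emeasure (density (distr ?P ?P ?s) (\<lambda>_. ennreal (c ^ card I))) (Pi\<^sub>E I A)
        = (\<Prod>i\<in>I. emeasure lborel (A i))" .
  qed simp
  have "(\<integral>\<^sup>+x. f x \<partial>?P) = (\<integral>\<^sup>+x. f x \<partial>density (distr ?P ?P ?s) (\<lambda>_. ennreal (c ^ card I)))"
    by (simp only: eq)
  also have "\<dots> = ennreal (c ^ card I) * (\<integral>\<^sup>+x. f (?s x) \<partial>?P)"
    using f s by (simp add: nn_integral_density nn_integral_distr nn_integral_cmult)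
  finally show ?thesis .
qed

section \<open>Moment generating function and tails of normal quadratic forms\<close>

text \<open>The argument is a function and not a vector because the columns are random elements of a
  product space \<open>PiM\<close>.\<close>

definition quad :: "nat \<Rightarrow> real mat \<Rightarrow> (nat \<Rightarrow> real) \<Rightarrow> real" where
  "quad p B x = scalar_prod (Matrix.vec p x) (B *\<^sub>v Matrix.vec p x)"

lemma quad_eq_sum:
  assumes "B \<in> carrier_mat p p"
  shows "quad p B x = (\<Sum>i<p. \<Sum>k<p. x i * (B $$ (i, k) * x k))"
  using assms by (simp add: quad_def scalar_prod_def atLeast0LessThan sum_distrib_left)

lemma quad_restrict: "quad p B (restrict x {..<p}) = quad p B x"
proof -
  have "Matrix.vec p (restrict x {..<p}) = Matrix.vec p x" by (intro eq_vecI) auto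
  then show ?thesis by (simp add: quad_def)
qed

lemma quad_scale:
  assumes "B \<in> carrier_mat p p"
  shows "quad p B (\<lambda>i\<in>{..<p}. c * x i) = c\<^sup>2 * quad p B x"
  using assms unfolding quad_restrict
  by (simp add: quad_eq_sum sum_distrib_left power2_eq_square mult_ac)

lemma quad_measurable [measurable]:
  assumes "B \<in> carrier_mat p p"
  shows "quad p B \<in> borel_measurable (PiM {..<p} (\<lambda>_. lborel))"
  unfolding quad_eq_sum[OF assms, abs_def] by measurable

text \<open>The density integrates to \<open>1\<close> because it is the density of a probability measure, so
  rescaling by \<open>sqrt (1 - t)\<close> evaluates the tilted integral without computing a Gaussian integral.\<close>

lemma (in prob_space) mvn_mgf_quad:
  assumes X: "distributed M (PiM {..<p} (\<lambda>_. lborel)) X (\<lambda>x. ennreal (mvn_density p Psi x))"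
    and B: "mat_inv Psi \<in> carrier_mat p p" and t: "t < 1"
  shows "(\<integral>\<^sup>+\<omega>. ennreal (exp (t / 2 * quad p (mat_inv Psi) (X \<omega>))) \<partial>M)
    = ennreal ((1 - t) powr (- real p / 2))"
proof -
  let ?P = "PiM {..<p} (\<lambda>_. lborel :: real measure)"
  let ?q = "quad p (mat_inv Psi)"
  let ?f = "\<lambda>x. ennreal (mvn_density p Psi x)"
  note [measurable] = quad_measurable[OF B]
  have f [measurable]: "?f \<in> borel_measurable ?P"
    using X by (rule distributed_borel_measurable)
  define D where "D = sqrt ((2 * pi) ^ p * det Psi)"
  have dens: "mvn_density p Psi x = exp (- ?q x / 2) / D" for x
    by (simp add: mvn_density_def quad_def D_def)
  define c where "c = sqrt (1 - t)"
  have c: "0 < c" "c\<^sup>2 = 1 - t" using t by (auto simp: c_def)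
  \<comment> \<open>As \<open>c^2 = 1 - t\<close>, the exponent \<open>- c^2 q / 2\<close> splits
    into \<open>- q / 2\<close> and the tilt \<open>t q / 2\<close>.\<close>
  have tilt: "mvn_density p Psi (\<lambda>i\<in>{..<p}. c * x i) = mvn_density p Psi x * exp (t / 2 * ?q x)" for x
    by (simp add: dens quad_scale[OF B] c(2) exp_add[symmetric] field_simps flip: exp_add)
  have "1 = (\<integral>\<^sup>+x. ?f x \<partial>?P)"
    using distributed_nn_integral[OF X, of "\<lambda>_. 1"] by (simp add: emeasure_space_1)
  also have "\<dots> = ennreal (c ^ p) * (\<integral>\<^sup>+x. ?f (\<lambda>i\<in>{..<p}. c * x i) \<partial>?P)"
    using nn_integral_PiM_lborel_scale[OF f c(1)] by simp
  also have "(\<integral>\<^sup>+x. ?f (\<lambda>i\<in>{..<p}. c * x i) \<partial>?P) = (\<integral>\<^sup>+x. ?f x * ennreal (exp (t / 2 * ?q x)) \<partial>?P)"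
    unfolding tilt by (simp add: ennreal_mult'')
  also have "\<dots> = (\<integral>\<^sup>+\<omega>. ennreal (exp (t / 2 * ?q (X \<omega>))) \<partial>M)"
    by (rule distributed_nn_integral[OF X]) measurable
  finally have eq: "ennreal (c ^ p) * (\<integral>\<^sup>+\<omega>. ennreal (exp (t / 2 * ?q (X \<omega>))) \<partial>M) = 1" by simp
  have cp: "(1 - t) powr (- real p / 2) * c ^ p = 1"
  proof -
    have "c ^ p = (1 - t) powr (real p / 2)"
      using t by (simp add: c_def powr_half_sqrt[symmetric] powr_powr flip: powr_realpow)
    then show ?thesis using t by (simp flip: powr_add)
  qed
  \<comment> \<open>Multiplying \<open>eq\<close> by the reciprocal of \<open>c ^ p\<close> isolates
    the integral, with neither division in \<open>ennreal\<close> nor a prior proof that the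
    integral is finite.\<close>
  have "ennreal ((1 - t) powr (- real p / 2)) =
      ennreal ((1 - t) powr (- real p / 2)) * (ennreal (c ^ p) * (\<integral>\<^sup>+\<omega>. ennreal (exp (t / 2 * ?q (X \<omega>))) \<partial>M))"
    by (simp only: eq mult_1_right)
  also have "\<dots> = ennreal ((1 - t) powr (- real p / 2) * c ^ p) * (\<integral>\<^sup>+\<omega>. ennreal (exp (t / 2 * ?q (X \<omega>))) \<partial>M)"
    using c(1) by (simp add: ennreal_mult' mult.assoc)
  finally show ?thesis unfolding cp by simp
qed

text \<open>Independence factorizes the expectation of the product. The result is the moment
  generating function, at \<open>t / 2\<close>, of a chi-square variable with \<open>m * p\<close>
  degrees of freedom.\<close>

lemma (in prob_space) mvn_mgf_quad_sum:
  assumes X: "\<And>j. j < m \<Longrightarrow>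
      distributed M (PiM {..<p} (\<lambda>_. lborel)) (X j) (\<lambda>x. ennreal (mvn_density p Psi x))"
    and ind: "indep_vars (\<lambda>_. PiM {..<p} (\<lambda>_. lborel)) X {..<m}"
    and B: "mat_inv Psi \<in> carrier_mat p p" and t: "t < 1"
  shows "(\<integral>\<^sup>+\<omega>. ennreal (exp (t / 2 * (\<Sum>j<m. quad p (mat_inv Psi) (X j \<omega>)))) \<partial>M)
    = ennreal ((1 - t) powr (- real (m * p) / 2))"
proof -
  let ?q = "quad p (mat_inv Psi)"
  note [measurable] = quad_measurable[OF B]
  have "(\<integral>\<^sup>+\<omega>. ennreal (exp (t / 2 * (\<Sum>j<m. ?q (X j \<omega>)))) \<partial>M)
      = (\<integral>\<^sup>+\<omega>. (\<Prod>j<m. ennreal (exp (t / 2 * ?q (X j \<omega>)))) \<partial>M)"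
    by (simp add: sum_distrib_left exp_sum prod_ennreal)
  also have "\<dots> = (\<Prod>j<m. \<integral>\<^sup>+\<omega>. ennreal (exp (t / 2 * ?q (X j \<omega>))) \<partial>M)"
    by (intro indep_vars_nn_integral indep_vars_compose2[OF ind]) auto
  also have "\<dots> = ennreal ((1 - t) powr (- real p / 2)) ^ m"
    using mvn_mgf_quad[OF X B t] by simp
  also have "\<dots> = ennreal (((1 - t) powr (- real p / 2)) ^ m)"
    by (simp add: ennreal_power)
  also have "((1 - t) powr (- real p / 2)) ^ m = (1 - t) powr (- real (m * p) / 2)"
    using t by (simp add: powr_powr mult_ac flip: powr_realpow)
  finally show ?thesis .
qed

text \<open>Chernoff's bound with the optimal tilt \<open>t = u / (1 + u)\<close>; positive \<open>u\<close> gives the upper and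
  negative \<open>u\<close> the lower tail.\<close>

lemma (in prob_space) mvn_quad_sum_chernoff:
  assumes X: "\<And>j. j < m \<Longrightarrow>
      distributed M (PiM {..<p} (\<lambda>_. lborel)) (X j) (\<lambda>x. ennreal (mvn_density p Psi x))"
    and ind: "indep_vars (\<lambda>_. PiM {..<p} (\<lambda>_. lborel)) X {..<m}"
    and B: "mat_inv Psi \<in> carrier_mat p p" and u: "-1 < u"
  shows "prob {\<omega> \<in> space M. (1 + u) * u * real (m * p) \<le> u * (\<Sum>j<m. quad p (mat_inv Psi) (X j \<omega>))}
    \<le> exp (- (u - ln (1 + u)) / 2) ^ (m * p)"
proof -
  define Q where "Q \<omega> = (\<Sum>j<m. quad p (mat_inv Psi) (X j \<omega>))" for \<omega>
  define N where "N = real (m * p)"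
  define t where "t = u / (1 + u)"
  have t: "t < 1" "1 - t = inverse (1 + u)" using u by (auto simp: t_def field_simps)
  note [measurable] = quad_measurable[OF B]
  have Xm: "X j \<in> measurable M (PiM {..<p} (\<lambda>_. lborel))" if "j < m" for j
    using X[OF that] by (rule distributed_measurable)
  have Q [measurable]: "Q \<in> borel_measurable M"
    unfolding Q_def[abs_def] using Xm by (intro borel_measurable_sum measurable_compose[OF _ quad_measurable[OF B]]) auto
  \<comment> \<open>Since \<open>t (1 + u) = u\<close>, the event compares \<open>t Q / 2\<close>
    with \<open>u N / 2\<close>. The two sides differ only by the positive factor
    \<open>2 (1 + u)\<close>, so either sign of \<open>u\<close> leads to the form required by
    Markov's inequality.\<close>
  have "{\<omega> \<in> space M. (1 + u) * u * N \<le> u * Q \<omega>}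
      = {\<omega> \<in> space M. 1 \<le> ennreal (exp (- u * N / 2)) * ennreal (exp (t / 2 * Q \<omega>))}"
  proof -
    have "(1 + u) * u * N \<le> u * Q \<omega> \<longleftrightarrow> 0 \<le> - u * N / 2 + t / 2 * Q \<omega>" for \<omega>
    proof -
      have "- u * N / 2 + t / 2 * Q \<omega> = (u * Q \<omega> - (1 + u) * u * N) / (2 * (1 + u))"
        using u by (simp add: t_def field_simps)
      then show ?thesis using u by (simp add: zero_le_divide_iff)
    qed
    then show ?thesis by (simp flip: ennreal_mult' exp_add)
  qed
  then have "emeasure M {\<omega> \<in> space M. (1 + u) * u * N \<le> u * Q \<omega>}
      \<le> ennreal (exp (- u * N / 2)) * (\<integral>\<^sup>+\<omega>. ennreal (exp (t / 2 * Q \<omega>)) * indicator (space M) \<omega> \<partial>M)"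
    by (simp only:) (rule nn_integral_Markov_inequality; measurable)
  also have "(\<integral>\<^sup>+\<omega>. ennreal (exp (t / 2 * Q \<omega>)) * indicator (space M) \<omega> \<partial>M)
      = (\<integral>\<^sup>+\<omega>. ennreal (exp (t / 2 * Q \<omega>)) \<partial>M)"
    by (intro nn_integral_cong) simp
  also have "\<dots> = ennreal ((1 - t) powr (- N / 2))"
    unfolding Q_def N_def by (rule mvn_mgf_quad_sum[OF X ind B t(1)])
  also have "(1 - t) powr (- N / 2) = exp (ln (1 + u) * N / 2)"
    using u by (simp add: t(2) powr_def ln_inverse)
  also have "ennreal (exp (- u * N / 2)) * ennreal (exp (ln (1 + u) * N / 2))
      = ennreal (exp (real (m * p) * (- (u - ln (1 + u)) / 2)))"
    by (simp add: N_def field_simps flip: ennreal_mult' exp_add)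
  also have "exp (real (m * p) * (- (u - ln (1 + u)) / 2)) = exp (- (u - ln (1 + u)) / 2) ^ (m * p)"
    by (rule exp_of_nat_mult)
  finally show ?thesis
    unfolding emeasure_eq_measure Q_def N_def by simp
qed

section \<open>Almost sure convergence by Borel-Cantelli\<close>

text \<open>Nothing relates the columns for different \<open>n\<close>, so this is a triangular
  array and not one sequence of partial sums. The tails for each \<open>n\<close> alone suffice:
  they decay geometrically in \<open>m n * p n\<close>, which by \<open>grow\<close> is at least
  \<open>n - 1\<close>, and hence are summable.\<close>

lemma (in prob_space) mvn_quad_sum_ratio_AE:
  assumes X: "\<And>n j. j < m n \<Longrightarrow>
      distributed M (PiM {..<p n} (\<lambda>_. lborel)) (X n j) (\<lambda>x. ennreal (mvn_density (p n) (Psi n) x))"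
    and ind: "\<And>n. indep_vars (\<lambda>_. PiM {..<p n} (\<lambda>_. lborel)) (X n) {..<m n}"
    and B: "\<And>n. mat_inv (Psi n) \<in> carrier_mat (p n) (p n)"
    and grow: "\<forall>\<^sub>F n in sequentially. n \<le> m n * p n + 1"
  shows "AE \<omega> in M. (\<lambda>n. (\<Sum>j<m n. quad (p n) (mat_inv (Psi n)) (X n j \<omega>)) / real (m n * p n)) \<longlonglongrightarrow> 1"
proof -
  define Q where "Q n \<omega> = (\<Sum>j<m n. quad (p n) (mat_inv (Psi n)) (X n j \<omega>))" for n \<omega>
  define N where "N n = m n * p n" for n
  have Q [measurable]: "Q n \<in> borel_measurable M" for n
    unfolding Q_def[abs_def]
    using distributed_measurable[OF X]
    by (intro borel_measurable_sum measurable_compose[OF _ quad_measurable[OF B]]) auto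
  have tail: "AE \<omega> in M. \<forall>\<^sub>F n in sequentially. u * Q n \<omega> < (1 + u) * u * real (N n)"
    if u: "-1 < u" "u \<noteq> 0" for u
  proof -
    define A where "A n = {\<omega> \<in> space M. (1 + u) * u * real (N n) \<le> u * Q n \<omega>}" for n
    define r where "r = exp (- (u - ln (1 + u)) / 2)"
    \<comment> \<open>Strictness, which comes from \<open>u \<noteq> 0\<close>, is what makes the
      rate \<open>r\<close> smaller than 1.\<close>
    have "ln (1 + u) < u"
      using ln_le_minus_one[of "1 + u"] ln_eq_minus_one[of "1 + u"] u by fastforce
    then have r: "0 < r" "r < 1" by (auto simp: r_def)
    have A: "A n \<in> sets M" for n unfolding A_def by measurable
    have "\<forall>\<^sub>F n in sequentially. norm (measure M (A n)) \<le> r ^ (n - 1)"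
      using grow
    proof eventually_elim
      case (elim n)
      have "measure M (A n) \<le> r ^ N n"
        using mvn_quad_sum_chernoff[OF X ind B u(1)] by (simp add: A_def r_def N_def Q_def)
      also have "\<dots> \<le> r ^ (n - 1)"
        using elim r by (intro power_decreasing) (auto simp: N_def)
      finally show ?case by simp
    qed
    moreover have "summable (\<lambda>n. r ^ (n - 1))"
      using r by (subst summable_Suc_iff[symmetric]) (simp add: summable_geometric)
    ultimately have "summable (\<lambda>n. measure M (A n))"
      by (rule summable_comparison_test_ev)
    then have "AE \<omega> in M. \<forall>\<^sub>F n in sequentially. \<omega> \<in> space M - A n"
      using A by (intro borel_cantelli_AE1) (auto simp: emeasure_eq_measure)
    then show ?thesis
      by eventually_elim (auto simp: A_def elim!: eventually_mono)
  qed
  \<comment> \<open>Countably many deviations allow a single null set for all tolerances. The shift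
    by 2 keeps the negative ones above \<open>-1\<close>, also for \<open>k = 0\<close>.\<close>
  have "AE \<omega> in M. \<forall>k :: nat.
      (\<forall>\<^sub>F n in sequentially. 1 / (k + 2) * Q n \<omega> < (1 + 1 / (k + 2)) * (1 / (k + 2)) * real (N n)) \<and>
      (\<forall>\<^sub>F n in sequentially. - (1 / (k + 2)) * Q n \<omega> < (1 + - (1 / (k + 2))) * - (1 / (k + 2)) * real (N n))"
    unfolding AE_all_countable by (intro allI AE_conjI tail) (auto simp: field_simps)
  then have "AE \<omega> in M. (\<lambda>n. Q n \<omega> / real (N n)) \<longlonglongrightarrow> 1"
  proof eventually_elim
    case (elim \<omega>)
    show ?case
    proof (rule tendstoI)
      fix e :: real assume "0 < e"
      then obtain k :: nat where k: "1 / e < k" using reals_Archimedean2 by blast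
      define u where "u = 1 / (real k + 2)"
      have u: "0 < u" "u < e"
        using k \<open>0 < e\<close> by (auto simp: u_def field_simps)
      have up: "\<forall>\<^sub>F n in sequentially. u * Q n \<omega> < (1 + u) * u * real (N n)"
        and lo: "\<forall>\<^sub>F n in sequentially. - u * Q n \<omega> < (1 + - u) * - u * real (N n)"
        using elim[rule_format, of k] by (auto simp: u_def)
      show "\<forall>\<^sub>F n in sequentially. dist (Q n \<omega> / real (N n)) 1 < e"
        \<comment> \<open>With \<open>n \<ge> 2\<close>, \<open>grow\<close> forces
          \<open>N n \<ge> 1\<close>, so dividing by it is legitimate.\<close>
        using up lo grow eventually_ge_at_top[of 2]
      proof eventually_elim
        case (elim n)
        then have N: "0 < N n" unfolding N_def by linarith
        have "u * Q n \<omega> < u * ((1 + u) * real (N n))" "u * ((1 - u) * real (N n)) < u * Q n \<omega>"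
          using elim by (auto simp: algebra_simps)
        then have "Q n \<omega> < (1 + u) * real (N n)" "(1 - u) * real (N n) < Q n \<omega>"
          using u by auto
        then have "Q n \<omega> / real (N n) < 1 + u" "1 - u < Q n \<omega> / real (N n)"
          using N by (auto simp: pos_divide_less_eq pos_less_divide_eq)
        then show ?case using u by (auto simp: dist_real_def)
      qed
    qed
  qed
  then show ?thesis by (simp add: Q_def N_def)
qed

section \<open>Comparison of \<open>b_S\<close> and \<open>b_star\<close> relative to the trace of
  W\<close>

theorem theorem5:
  fixes M :: "'w measure"
    and p :: "nat \<Rightarrow> nat"
    and Psi :: "nat \<Rightarrow> real mat"
    and Y :: "nat \<Rightarrow> 'w \<Rightarrow> nat \<Rightarrow> nat \<Rightarrow> real"
    and g :: "nat \<Rightarrow> real mat \<Rightarrow> real"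
    and c0 \<gamma> c1 c2 \<alpha> :: real
  assumes M: "prob_space M"
    and Psi_pd: "\<And>n. sym_posdef (p n) (Psi n)"
    and Y_cols: "\<And>n j. j < n - 1 \<Longrightarrow>
          distributed M (PiM {..<p n} (\<lambda>_. lborel)) (\<lambda>\<omega>. \<lambda>i\<in>{..<p n}. Y n \<omega> i j)
            (\<lambda>x. ennreal (mvn_density (p n) (Psi n) x))"
    and Y_indep: "\<And>n. prob_space.indep_vars M (\<lambda>_. PiM {..<p n} (\<lambda>_. lborel))
          (\<lambda>j \<omega>. \<lambda>i\<in>{..<p n}. Y n \<omega> i j) {..<n - 1}"
    and c0: "c0 \<ge> 0"
    and g_nonneg: "\<And>n A. g n A \<ge> 0"
    and A1: "(\<lambda>n. real n / real (p n)) \<longlonglongrightarrow> \<gamma>" "0 < \<gamma>" "\<gamma> \<noteq> 1"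
    and A2_bounds: "0 < c1" "c1 \<le> c2"
      "\<And>n r. poly (char_poly (Psi n)) r = 0 \<Longrightarrow> c1 \<le> r \<and> r \<le> c2"
    and A2_esd: "\<exists>H. real_distribution H \<and>
          (\<forall>t. isCont (cdf H) t \<longrightarrow> (\<lambda>n. esd (Psi n) t) \<longlonglongrightarrow> cdf H t)"
    and A3: "0 < \<alpha>"
      "AE \<omega> in M. (\<lambda>n. g n (Wmat (p n) n (Y n \<omega>)) / real n) \<longlonglongrightarrow> \<alpha>"
  shows "AE \<omega> in M. (\<lambda>n.
     let W = Wmat (p n) n (Y n \<omega>); a = g n W in
       \<bar>b_S n (p n) c0 W a / mat_tr W - b_star n (p n) c0 W a (Psi n) / mat_tr W\<bar>)
     \<longlonglongrightarrow> 0"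
proof -
  interpret prob_space M by (rule M)
  note I = sym_posdef_mat_inv[OF Psi_pd]
  define Q where "Q n \<omega> = (\<Sum>j<n - 1. quad (p n) (mat_inv (Psi n)) (\<lambda>i. Y n \<omega> i j))" for n \<omega>
  define N where "N n = (n - 1) * p n" for n
  \<comment> \<open>A quotient by 0 is 0, so a positive limit of \<open>n / p n\<close> excludes
    \<open>p n = 0\<close> eventually.\<close>
  have "\<forall>\<^sub>F n in sequentially. 0 < real n / real (p n)"
    using A1 by (intro order_tendstoD(1))
  then have grow: "\<forall>\<^sub>F n in sequentially. n \<le> N n + 1"
  proof eventually_elim
    case (elim n)
    then have "1 \<le> p n" by (cases "p n") auto
    then have "(n - 1) * 1 \<le> (n - 1) * p n" by (intro mult_le_mono2)
    then show ?case unfolding N_def by linarith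
  qed
  have "filterlim (\<lambda>n. real (N n)) at_top sequentially"
  proof (rule filterlim_at_top_mono)
    show "filterlim (\<lambda>n. real n + - 1) at_top sequentially"
      using filterlim_tendsto_add_at_top[OF tendsto_const filterlim_real_sequentially, of "- 1 :: real"]
      by (simp add: add.commute)
    show "\<forall>\<^sub>F n in sequentially. real n + - 1 \<le> real (N n)"
      using grow by eventually_elim linarith
  qed
  then have N0: "(\<lambda>n. 2 / real (N n)) \<longlonglongrightarrow> 0"
    by (intro tendsto_divide_0[OF tendsto_const] filterlim_at_top_imp_at_infinity)
  have "AE \<omega> in M. (\<lambda>n. Q n \<omega> / real (N n)) \<longlonglongrightarrow> 1"
    \<comment> \<open>The distributional assumptions concern columns restricted to the indices below
      \<open>p n\<close>; \<open>quad\<close> reads no others.\<close>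
    using mvn_quad_sum_ratio_AE[where m = "\<lambda>n. n - 1" and p = p and Psi = Psi
        and X = "\<lambda>n j \<omega>. \<lambda>i\<in>{..<p n}. Y n \<omega> i j", OF Y_cols Y_indep I(1) grow[unfolded N_def]]
    by (simp add: quad_restrict Q_def N_def)
  then show ?thesis
  proof eventually_elim
    case (elim \<omega>)
    let ?W = "\<lambda>n. Wmat (p n) n (Y n \<omega>)"
    let ?d = "\<lambda>n. \<bar>b_S n (p n) c0 (?W n) (g n (?W n)) / mat_tr (?W n)
        - b_star n (p n) c0 (?W n) (g n (?W n)) (Psi n) / mat_tr (?W n)\<bar>"
    \<comment> \<open>This is the majorant \<open>|N - 2 - Q| / (c1 Q)\<close> obtained from
      \<open>tr W \<ge> c1 Q\<close>, with numerator and denominator divided by \<open>N\<close> so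
      that its limit can be read off.\<close>
    let ?e = "\<lambda>n. \<bar>1 - 2 / real (N n) - Q n \<omega> / real (N n)\<bar> / (c1 * (Q n \<omega> / real (N n)))"
    have "?e \<longlonglongrightarrow> \<bar>1 - 0 - 1\<bar> / (c1 * 1)"
      using A2_bounds(1) by (intro tendsto_intros elim N0) auto
    then have e0: "?e \<longlonglongrightarrow> 0" by simp
    have "\<forall>\<^sub>F n in sequentially. 0 < Q n \<omega> / real (N n)"
      using elim by (rule order_tendstoD(1)) simp
    then have "\<forall>\<^sub>F n in sequentially. ?d n \<le> ?e n"
      using eventually_ge_at_top[of 1]
    proof eventually_elim
      case (elim n)
      have N: "0 < real (N n)" and Q: "0 < Q n \<omega>"
        using elim(1) by (auto simp: zero_less_divide_iff)
      \<comment> \<open>\<open>N\<close> uses truncated subtraction and agrees with the real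
        expression in \<open>b_S\<close> only for \<open>n \<ge> 1\<close>.\<close>
      have NN: "real (N n) = (real n - 1) * real (p n)"
        using elim(2) by (simp add: N_def of_nat_diff)
      have trQ: "mat_tr (?W n * mat_inv (Psi n)) = Q n \<omega>"
        by (simp add: mat_tr_Wmat_mult[OF I(1)] Q_def quad_def)
      have "c1 * Q n \<omega> \<le> mat_tr (?W n)"
        unfolding mat_tr_Wmat Q_def quad_def sum_distrib_left
        using A2_bounds by (intro sum_mono mat_inv_quadratic_form_le[OF Psi_pd]) auto
      moreover have "0 < c1 * Q n \<omega>" using A2_bounds(1) Q by simp
      moreover have "?d n = \<bar>real (N n) - 2 - Q n \<omega>\<bar> / \<bar>mat_tr (?W n)\<bar>"
        unfolding diff_divide_distrib[symmetric] abs_divide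
        by (simp add: b_S_def b_star_def trQ NN algebra_simps)
      ultimately have "?d n \<le> \<bar>real (N n) - 2 - Q n \<omega>\<bar> / (c1 * Q n \<omega>)"
        by (simp add: divide_left_mono)
      also have "\<dots> = ?e n"
      proof -
        have "1 - 2 / real (N n) - Q n \<omega> / real (N n) = (real (N n) - 2 - Q n \<omega>) / real (N n)"
          using N by (simp add: field_simps)
        then show ?thesis using N by (simp add: abs_divide)
      qed
      finally show ?case .
    qed
    then have "?d \<longlonglongrightarrow> 0"
      by (intro tendsto_sandwich[OF _ _ tendsto_const e0]) auto
    then show ?case by (simp add: Let_def)
  qed
qed

end
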